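(* Let $0<\alpha<1$, $L,U\in\mathbb{R}^\eta$, $[L,U]=\{x\in\mathbb{R}^\eta:L_i\le x_i\le U_i\ \forall i\}$, and take an affine function $f(x)=w\cdot x+b$ over the input domain $[L,U]$, taking both a strictly positive and a strictly negative value on $[L,U]$. Let $M^+=\max_{x\in[L,U]}f(x)$ and $M^-=\min_{x\in[L,U]}f(x)$. The following is a valid formulation for $S=\{(x,y)\in[L,U]\times\mathbb{R}: y=\max\{\alpha f(x),f(x)\}\}$: $$\text{(a)}\ y\ge f(x),\qquad\text{(b)}\ y\ge\alpha f(x),$$ $$\text{(c)}\ y\le f(x)-(1-\alpha)M^-(1-z),\qquad\text{(d)}\ y\le\alpha f(x)-(\alpha-1)M^+z,$$ $$\text{(e)}\ (x,y,z)\in[L,U]\times\mathbb{R}\times[0,1],\qquad\text{(f)}\ z\in\{0,1\}.$$ Moreover, an ideal formulation of $S$ is given by (a)–(f) along with the constraints $$\text{(g)}\quad y\le\left(\sum_{i\in I}w_i(x_i-\breve L_i(1-z))+\left(b+\sum_{i\notin I}w_i\breve U_i\right)z\right)+\alpha\left(\sum_{i\notin I}w_i(x_i-\breve U_iz)+\left(b+\sum_{i\in I}w_i\breve L_i\right)(1-z)\right)\quad\forall I\subseteq\{1,\dots,\eta\}.$$ Additionally, the most violated inequality from the family (g) can be separated in $\mathcal{O}(\eta)$ time. Finally, each inequality in (a)–(d) and (g) is facet-defining.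
   Context: For each $i$: $\breve L_i=L_i$ and $\breve U_i=U_i$ if $w_i\ge0$; $\breve L_i=U_i$ and $\breve U_i=L_i$ if $w_i<0$. MIP terminology: a (valid) MIP formulation of $S\subseteq\mathbb{R}^{\eta+1}$ consists of linear constraints on $(x,y,z)\in\mathbb{R}^\eta\times\mathbb{R}\times\mathbb{R}^q$ defining a polyhedron $Q$ (its LP relaxation), together with $z\in\{0,1\}^q$, such that $S=\operatorname{Proj}_{x,y}(Q\cap(\mathbb{R}^{\eta+1}\times\{0,1\}^q))$. It is ideal if every extreme point of $Q$ lies in $\mathbb{R}^{\eta+1}\times\{0,1\}^q$. An inequality is valid if every point of $\underline Q=\{(x,y,z)\in Q: z\in\{0,1\}^q\}$ satisfies it; a valid inequality is facet-defining if the dimension of (the affine hull of) the points of $\underline Q$ satisfying it at equality is exactly one less than the dimension of (the affine hull of) $\underline Q$. Separation over a family of inequalities: find an inequality of the family violated by a given point or certify that none exists. *)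

theory Defs
  imports "HOL-Analysis.Analysis" "HOL-Library.Landau_Symbols"
begin

section \<open>Mixed-integer programming formulations\<close>

text \<open>The type of the integer variables is an arbitrary Euclidean space; for a single
  variable it is \<^typ>\<open>real\<close>, where \<^const>\<open>Basis\<close> is \<open>{1}\<close>.\<close>

definition binary :: "'z::euclidean_space set" where
  "binary = {z. \<forall>i\<in>Basis. z \<bullet> i \<in> {0, 1}}"

definition binary_part :: "('a \<times> real \<times> 'z::euclidean_space) set \<Rightarrow> ('a \<times> real \<times> 'z) set" where
  "binary_part Q = {(x, y, z) \<in> Q. z \<in> binary}"

definition mip_formulation ::
  "('a::euclidean_space \<times> real \<times> 'z::euclidean_space) set \<Rightarrow> ('a \<times> real) set \<Rightarrow> bool" where
  "mip_formulation Q S \<longleftrightarrow> polyhedron Q \<and> S = {(x, y). \<exists>z. (x, y, z) \<in> binary_part Q}"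

definition ideal_formulation ::
  "('a::euclidean_space \<times> real \<times> 'z::euclidean_space) set \<Rightarrow> ('a \<times> real) set \<Rightarrow> bool" where
  "ideal_formulation Q S \<longleftrightarrow>
     mip_formulation Q S \<and> (\<forall>p. p extreme_point_of Q \<longrightarrow> p \<in> UNIV \<times> UNIV \<times> binary)"

text \<open>The inequality \<open>lhs p \<le> rhs p\<close>, both sides being affine functions of the point.
  Dimensions are relative to the affine hull of the binary points of \<open>Q\<close>, which need not be
  full-dimensional (for instance if a variable is fixed by its bounds).\<close>

definition valid_inequality ::
  "('a \<times> real \<times> 'z::euclidean_space) set \<Rightarrow> ('a \<times> real \<times> 'z \<Rightarrow> real) \<Rightarrow> ('a \<times> real \<times> 'z \<Rightarrow> real) \<Rightarrow> bool" where
  "valid_inequality Q lhs rhs \<longleftrightarrow> (\<forall>p \<in> binary_part Q. lhs p \<le> rhs p)"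

definition facet_defining ::
  "('a::euclidean_space \<times> real \<times> 'z::euclidean_space) set \<Rightarrow>
   ('a \<times> real \<times> 'z \<Rightarrow> real) \<Rightarrow> ('a \<times> real \<times> 'z \<Rightarrow> real) \<Rightarrow> bool" where
  "facet_defining Q lhs rhs \<longleftrightarrow> valid_inequality Q lhs rhs \<and>
     aff_dim {p \<in> binary_part Q. lhs p = rhs p} = aff_dim (binary_part Q) - 1"


section \<open>The leaky ReLU neuron\<close>

definition aff :: "real^'n \<Rightarrow> real \<Rightarrow> real^'n \<Rightarrow> real" where
  "aff w b x = w \<bullet> x + b"

definition leaky_graph ::
  "real \<Rightarrow> real^'n \<Rightarrow> real \<Rightarrow> real^'n \<Rightarrow> real^'n \<Rightarrow> ((real^'n) \<times> real) set" where
  "leaky_graph \<alpha> w b L U = {(x, y). x \<in> cbox L U \<and> y = max (\<alpha> * aff w b x) (aff w b x)}"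

text \<open>On a nonempty compact box the supremum and the infimum of \<^const>\<open>aff\<close> are attained,
  so these are the maximum and the minimum.\<close>

definition Mplus :: "real^'n \<Rightarrow> real \<Rightarrow> real^'n \<Rightarrow> real^'n \<Rightarrow> real" where
  "Mplus w b L U = (SUP x\<in>cbox L U. aff w b x)"

definition Mminus :: "real^'n \<Rightarrow> real \<Rightarrow> real^'n \<Rightarrow> real^'n \<Rightarrow> real" where
  "Mminus w b L U = (INF x\<in>cbox L U. aff w b x)"

definition bigM_lower ::
  "real \<Rightarrow> real^'n \<Rightarrow> real \<Rightarrow> real^'n \<Rightarrow> real^'n \<Rightarrow> real^'n \<Rightarrow> real \<Rightarrow> real" where
  "bigM_lower \<alpha> w b L U x z = aff w b x - (1 - \<alpha>) * Mminus w b L U * (1 - z)"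

definition bigM_upper ::
  "real \<Rightarrow> real^'n \<Rightarrow> real \<Rightarrow> real^'n \<Rightarrow> real^'n \<Rightarrow> real^'n \<Rightarrow> real \<Rightarrow> real" where
  "bigM_upper \<alpha> w b L U x z = \<alpha> * aff w b x - (\<alpha> - 1) * Mplus w b L U * z"

definition bigM_polyhedron ::
  "real \<Rightarrow> real^'n \<Rightarrow> real \<Rightarrow> real^'n \<Rightarrow> real^'n \<Rightarrow> ((real^'n) \<times> real \<times> real) set" where
  "bigM_polyhedron \<alpha> w b L U = {(x, y, z).
     y \<ge> aff w b x \<and> y \<ge> \<alpha> * aff w b x \<and>
     y \<le> bigM_lower \<alpha> w b L U x z \<and> y \<le> bigM_upper \<alpha> w b L U x z \<and>
     x \<in> cbox L U \<and> z \<in> {0..1}}"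

text \<open>The exponential family is stated for vectors given as functions on a finite index set
  \<open>N\<close>: it is used both with \<open>N = UNIV :: 'n set\<close> for vectors of type \<open>real^'n\<close> and with
  \<open>N = {..<\<eta>}\<close> in the separation statement, where \<open>\<eta>\<close> varies inside the formula.\<close>

definition breve_L :: "('i \<Rightarrow> real) \<Rightarrow> ('i \<Rightarrow> real) \<Rightarrow> ('i \<Rightarrow> real) \<Rightarrow> 'i \<Rightarrow> real" where
  "breve_L w L U i = (if w i \<ge> 0 then L i else U i)"

definition breve_U :: "('i \<Rightarrow> real) \<Rightarrow> ('i \<Rightarrow> real) \<Rightarrow> ('i \<Rightarrow> real) \<Rightarrow> 'i \<Rightarrow> real" where
  "breve_U w L U i = (if w i \<ge> 0 then U i else L i)"

definition family_rhs ::
  "'i set \<Rightarrow> real \<Rightarrow> ('i \<Rightarrow> real) \<Rightarrow> real \<Rightarrow> ('i \<Rightarrow> real) \<Rightarrow> ('i \<Rightarrow> real) \<Rightarrow>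
   'i set \<Rightarrow> ('i \<Rightarrow> real) \<Rightarrow> real \<Rightarrow> real" where
  "family_rhs N \<alpha> w b L U I x z =
     ((\<Sum>i\<in>I. w i * (x i - breve_L w L U i * (1 - z)))
        + (b + (\<Sum>i\<in>N - I. w i * breve_U w L U i)) * z)
     + \<alpha> * ((\<Sum>i\<in>N - I. w i * (x i - breve_U w L U i * z))
        + (b + (\<Sum>i\<in>I. w i * breve_L w L U i)) * (1 - z))"

definition ideal_polyhedron ::
  "real \<Rightarrow> real^'n \<Rightarrow> real \<Rightarrow> real^'n \<Rightarrow> real^'n \<Rightarrow> ((real^'n) \<times> real \<times> real) set" where
  "ideal_polyhedron \<alpha> w b L U = bigM_polyhedron \<alpha> w b L U \<inter>
     {(x, y, z). \<forall>I \<subseteq> UNIV. y \<le> family_rhs UNIV \<alpha> (($) w) b (($) L) (($) U) I (($) x) z}"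


section \<open>A real RAM\<close>

text \<open>Running times refer to a structured real RAM with unit cost per instruction and per
  test. A state consists of index registers (natural numbers), real registers, and arrays of
  reals accessed through index registers. Index registers can only be reset and incremented,
  so unit cost is harmless for them. A program mentions only fixed registers and arrays and
  fixed integer constants; it does not depend on the size of the input.\<close>

datatype state = State (idx: "nat \<Rightarrow> nat") (reg: "nat \<Rightarrow> real") (arr: "nat \<Rightarrow> nat \<Rightarrow> real")

datatype instr =
    RConst nat int
  | RAdd nat nat nat
  | RSub nat nat nat
  | RMul nat nat nat
  | Load nat nat nat
  | Store nat nat nat
  | IZero nat
  | ISuc nat

fun exec :: "instr \<Rightarrow> state \<Rightarrow> state" where
  "exec (RConst d c) (State i r a) = State i (r(d := of_int c)) a"
| "exec (RAdd d p q) (State i r a) = State i (r(d := r p + r q)) a"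
| "exec (RSub d p q) (State i r a) = State i (r(d := r p - r q)) a"
| "exec (RMul d p q) (State i r a) = State i (r(d := r p * r q)) a"
| "exec (Load d m k) (State i r a) = State i (r(d := a m (i k))) a"
| "exec (Store m k p) (State i r a) = State i r (a(m := (a m)(i k := r p)))"
| "exec (IZero k) (State i r a) = State (i(k := 0)) r a"
| "exec (ISuc k) (State i r a) = State (i(k := Suc (i k))) r a"

datatype test =
    RLe nat nat
  | ILess nat nat

fun holds :: "test \<Rightarrow> state \<Rightarrow> bool" where
  "holds (RLe p q) s \<longleftrightarrow> reg s p \<le> reg s q"
| "holds (ILess k l) s \<longleftrightarrow> idx s k < idx s l"

datatype com =
    Skip
  | Do instr
  | Seq com com
  | Cond test com com
  | While test com

text \<open>\<open>runs c s t s'\<close>: started in \<open>s\<close>, the program \<open>c\<close> terminates in \<open>s'\<close> after \<open>t\<close> steps.\<close>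

inductive runs :: "com \<Rightarrow> state \<Rightarrow> nat \<Rightarrow> state \<Rightarrow> bool" where
  runs_Skip: "runs Skip s 0 s"
| runs_Do: "runs (Do ins) s 1 (exec ins s)"
| runs_Seq: "runs c1 s t1 s1 \<Longrightarrow> runs c2 s1 t2 s2 \<Longrightarrow> runs (Seq c1 c2) s (t1 + t2) s2"
| runs_CondTrue: "holds e s \<Longrightarrow> runs c1 s t s' \<Longrightarrow> runs (Cond e c1 c2) s (1 + t) s'"
| runs_CondFalse: "\<not> holds e s \<Longrightarrow> runs c2 s t s' \<Longrightarrow> runs (Cond e c1 c2) s (1 + t) s'"
| runs_WhileFalse: "\<not> holds e s \<Longrightarrow> runs (While e c) s 1 s"
| runs_WhileTrue: "holds e s \<Longrightarrow> runs c s t1 s1 \<Longrightarrow> runs (While e c) s1 t2 s2 \<Longrightarrow>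
    runs (While e c) s (1 + t1 + t2) s2"


section \<open>Separation\<close>

definition leaky_instance ::
  "nat \<Rightarrow> real \<Rightarrow> (nat \<Rightarrow> real) \<Rightarrow> real \<Rightarrow> (nat \<Rightarrow> real) \<Rightarrow> (nat \<Rightarrow> real) \<Rightarrow> bool" where
  "leaky_instance \<eta> \<alpha> w b L U \<longleftrightarrow> 0 < \<alpha> \<and> \<alpha> < 1 \<and>
     (\<exists>x. (\<forall>i<\<eta>. L i \<le> x i \<and> x i \<le> U i) \<and> (\<Sum>i<\<eta>. w i * x i) + b > 0) \<and>
     (\<exists>x. (\<forall>i<\<eta>. L i \<le> x i \<and> x i \<le> U i) \<and> (\<Sum>i<\<eta>. w i * x i) + b < 0)"

text \<open>Index register 0 holds \<open>\<eta>\<close>, the real registers 0 to 3 hold the scalars and the arrays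
  0 to 3 hold the vectors; everything else, including array cells beyond \<open>\<eta>\<close>, is 0.\<close>

definition input_state ::
  "nat \<Rightarrow> real \<Rightarrow> (nat \<Rightarrow> real) \<Rightarrow> real \<Rightarrow> (nat \<Rightarrow> real) \<Rightarrow> (nat \<Rightarrow> real) \<Rightarrow>
   (nat \<Rightarrow> real) \<Rightarrow> real \<Rightarrow> real \<Rightarrow> state" where
  "input_state \<eta> \<alpha> w b L U x y z = State
     ((\<lambda>_. 0)(0 := \<eta>))
     ((\<lambda>_. 0)(0 := \<alpha>, 1 := b, 2 := y, 3 := z))
     ((\<lambda>_ _. 0)(0 := \<lambda>i. if i < \<eta> then w i else 0,
                1 := \<lambda>i. if i < \<eta> then L i else 0,
                2 := \<lambda>i. if i < \<eta> then U i else 0,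
                3 := \<lambda>i. if i < \<eta> then x i else 0))"

text \<open>The answer is read off real register 0 (1: a violated inequality was found, 0: there is
  none) and array 4 (the characteristic vector of the index set of that inequality). The
  violation of \<open>y \<le> rhs\<close> is \<open>y - rhs\<close>.\<close>

definition output_set :: "nat \<Rightarrow> state \<Rightarrow> nat set" where
  "output_set \<eta> s = {i. i < \<eta> \<and> arr s 4 i = 1}"

definition correct_separation ::
  "nat \<Rightarrow> real \<Rightarrow> (nat \<Rightarrow> real) \<Rightarrow> real \<Rightarrow> (nat \<Rightarrow> real) \<Rightarrow> (nat \<Rightarrow> real) \<Rightarrow>
   (nat \<Rightarrow> real) \<Rightarrow> real \<Rightarrow> real \<Rightarrow> state \<Rightarrow> bool" where
  "correct_separation \<eta> \<alpha> w b L U x y z s \<longleftrightarrow>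
     (let violation = (\<lambda>I. y - family_rhs {..<\<eta>} \<alpha> w b L U I x z) in
      reg s 0 = 1 \<and> violation (output_set \<eta> s) > 0 \<and>
        (\<forall>I \<subseteq> {..<\<eta>}. violation I \<le> violation (output_set \<eta> s))
      \<or> reg s 0 = 0 \<and> (\<forall>I \<subseteq> {..<\<eta>}. violation I \<le> 0))"

definition separable_in_time :: "(nat \<Rightarrow> real) \<Rightarrow> bool" where
  "separable_in_time T \<longleftrightarrow>
     (\<exists>P. \<forall>\<eta> \<alpha> w b L U x y z. leaky_instance \<eta> \<alpha> w b L U \<longrightarrow>
        (\<exists>t s. runs P (input_state \<eta> \<alpha> w b L U x y z) t s \<and> real t \<le> T \<eta> \<and>
           correct_separation \<eta> \<alpha> w b L U x y z s))"

end

theory Submission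
  imports Defs
begin

text \<open>Write \<open>y = \<alpha> f(x) + (1 - \<alpha>) s\<close>. In terms of \<open>s\<close> the lower bounds on \<open>y\<close> read
  \<open>s \<ge> max 0 (f x)\<close>, and the family (g) reads \<open>s \<le> b z + w \<bullet> u\<close>, where \<open>u\<close> agrees with
  \<open>x - (1 - z) lower\<close> on \<open>I\<close> and with \<open>z upper\<close> outside \<open>I\<close>; \<open>lower\<close> and \<open>upper\<close> are
  the vertices of the box where \<open>f\<close> is minimal and maximal. The bounds (c) and (d) are the
  extreme cases \<open>I = UNIV\<close> and \<open>I = {}\<close>.

  A point with \<open>0 < z < 1\<close> is a convex combination of \<open>(x0, \<alpha> f(x0), 0)\<close> and
  \<open>(x1, f(x1), 1)\<close> with weights \<open>1 - z\<close> and \<open>z\<close> precisely if \<open>x\<close> splits accordingly and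
  \<open>z f(x1) = s\<close>. For \<open>x0 = x1 = x\<close> one has \<open>z f(x) \<le> max 0 (f x) \<le> s\<close>, while a suitable
  \<open>I\<close> provides a split with \<open>z f(x1) \<ge> s\<close>; a split in between has equality.

  The terms of (g) may be chosen separately for each index, so the most violated inequality
  takes the smaller of the two terms everywhere.\<close>

section \<open>Affine functionals, polyhedra and facets\<close>

text \<open>The normal vector and the constant appear explicitly, so that sublevel and zero sets are
  halfspaces and hyperplanes.\<close>

definition affine_functional :: "('a::euclidean_space \<Rightarrow> real) \<Rightarrow> bool" where
  "affine_functional g \<longleftrightarrow> (\<exists>h c. \<forall>p. g p = h \<bullet> p + c)"

lemma affine_functional_inner: "affine_functional (\<lambda>p. h \<bullet> p)"
  unfolding affine_functional_def by (metis add.right_neutral)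

lemma affine_functional_const: "affine_functional (\<lambda>p. c)"
  unfolding affine_functional_def by (metis add.left_neutral inner_zero_left)

lemma affine_functional_add:
  assumes "affine_functional g" "affine_functional g'"
  shows "affine_functional (\<lambda>p. g p + g' p)"
proof -
  obtain h c h' c' where "\<And>p. g p = h \<bullet> p + c" "\<And>p. g' p = h' \<bullet> p + c'"
    using assms unfolding affine_functional_def by blast
  then have "\<forall>p. g p + g' p = (h + h') \<bullet> p + (c + c')" by (simp add: inner_add_left)
  then show ?thesis unfolding affine_functional_def by blast
qed

lemma affine_functional_scale:
  assumes "affine_functional g"
  shows "affine_functional (\<lambda>p. a * g p)"
proof -
  obtain h c where "\<And>p. g p = h \<bullet> p + c"
    using assms unfolding affine_functional_def by blast
  then have "\<forall>p. a * g p = (a *\<^sub>R h) \<bullet> p + a * c" by (simp add: algebra_simps)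
  then show ?thesis unfolding affine_functional_def by blast
qed

lemma affine_functional_diff:
  assumes "affine_functional g" "affine_functional g'"
  shows "affine_functional (\<lambda>p. g p - g' p)"
  using affine_functional_add[OF assms(1) affine_functional_scale[OF assms(2), of "-1"]] by simp

lemma affine_functional_sum:
  assumes "\<And>i. i \<in> A \<Longrightarrow> affine_functional (g i)"
  shows "affine_functional (\<lambda>p. \<Sum>i\<in>A. g i p)"
  using assms
  by (induction A rule: infinite_finite_induct)
     (auto intro: affine_functional_const affine_functional_add)

lemma affine_functional_mult_right:
  "affine_functional g \<Longrightarrow> affine_functional (\<lambda>p. g p * a)"
  using affine_functional_scale[of g a] by (simp add: mult.commute)

lemmas affine_functional_intros =
  affine_functional_const affine_functional_add affine_functional_scale
  affine_functional_diff affine_functional_sum affine_functional_mult_right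

lemma affine_functional_convex_combination:
  assumes "affine_functional g"
  shows "g ((1 - u) *\<^sub>R p + u *\<^sub>R q) = (1 - u) * g p + u * g q"
proof -
  obtain h c where "\<And>p. g p = h \<bullet> p + c"
    using assms unfolding affine_functional_def by blast
  then show ?thesis by (simp add: algebra_simps)
qed

lemma affine_zero_set:
  assumes "affine_functional g"
  shows "affine {p. g p = 0}"
proof -
  obtain h c where "\<And>p. g p = h \<bullet> p + c"
    using assms unfolding affine_functional_def by blast
  then have "{p. g p = 0} = {p. h \<bullet> p = - c}" by auto
  then show ?thesis by (simp add: affine_hyperplane)
qed

lemma polyhedron_Collect_le:
  assumes "affine_functional g" "affine_functional g'"
  shows "polyhedron {p. g p \<le> g' p}"
proof -
  obtain h c where "\<And>p. g p - g' p = h \<bullet> p + c"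
    using affine_functional_diff[OF assms] unfolding affine_functional_def by blast
  then have "g p \<le> g' p \<longleftrightarrow> h \<bullet> p \<le> - c" for p
    by (smt (verit))
  then show ?thesis by (simp add: polyhedron_halfspace_le)
qed

lemma polyhedron_Collect_conj:
  assumes "polyhedron {p. P p}" "polyhedron {p. Q p}"
  shows "polyhedron {p. P p \<and> Q p}"
  using polyhedron_Int[OF assms] by (simp add: Collect_conj_eq)

lemma polyhedron_Collect_ball:
  assumes "finite A" "\<And>i. i \<in> A \<Longrightarrow> polyhedron {p. P i p}"
  shows "polyhedron {p. \<forall>i\<in>A. P i p}"
proof -
  have "polyhedron (\<Inter>((\<lambda>i. {p. P i p}) ` A))"
    using assms by (intro polyhedron_Inter) auto
  moreover have "\<Inter>((\<lambda>i. {p. P i p}) ` A) = {p. \<forall>i\<in>A. P i p}" by auto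
  ultimately show ?thesis by simp
qed

section \<open>Affine hulls and facets by duality\<close>

text \<open>Relative to a base point \<open>a\<close> of \<open>S\<close>, the part \<open>k\<close>
  of \<open>p - a\<close> orthogonal to the directions of \<open>S\<close> is itself a functional
  constant on \<open>S\<close>. By \<open>vanish\<close> it takes the same value at
  \<open>p\<close>, which forces \<open>k \<bullet> k = 0\<close>.\<close>

lemma subset_affine_hull_dual:
  fixes S :: "'a::euclidean_space set"
  assumes "S \<noteq> {}"
    and vanish: "\<And>k e. (\<And>p. p \<in> S \<Longrightarrow> k \<bullet> p = e) \<Longrightarrow> (\<And>p. p \<in> B \<Longrightarrow> k \<bullet> p = e)"
  shows "B \<subseteq> affine hull S"
proof
  fix p assume p: "p \<in> B"
  obtain a where a: "a \<in> S" using assms by blast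
  let ?V = "(\<lambda>s. - a + s) ` S"
  obtain y k where y: "y \<in> span ?V" and k: "\<And>v. v \<in> span ?V \<Longrightarrow> orthogonal k v"
    and yk: "p - a = y + k"
    using orthogonal_subspace_decomp_exists[of ?V "p - a"] by blast
  have "k \<bullet> s = k \<bullet> a" if "s \<in> S" for s
    using k[of "- a + s"] that by (simp add: span_base orthogonal_def inner_diff_right)
  then have "k \<bullet> p = k \<bullet> a" using vanish p by blast
  then have "k \<bullet> (y + k) = 0" unfolding yk[symmetric] by (simp add: inner_diff_right)
  moreover have "k \<bullet> y = 0" using k[OF y] by (simp add: orthogonal_def)
  ultimately have "k = 0" by (simp add: inner_right_distrib)
  then have "p = a + y" using yk by (simp add: algebra_simps)
  then show "p \<in> affine hull S" using y by (auto simp: affine_hull_span_gen[OF hull_inc[OF a]])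
qed

text \<open>Dual dimension count: the face spans a hyperplane of the affine hull of the binary
  points as soon as every functional that is constant on it is a multiple of the slack on them.\<close>

lemma facet_defining_dual:
  assumes lhs: "affine_functional lhs" and rhs: "affine_functional rhs"
    and valid: "\<And>p. p \<in> binary_part Q \<Longrightarrow> lhs p \<le> rhs p"
    and p0: "p0 \<in> binary_part Q" "lhs p0 = rhs p0"
    and a: "a \<in> binary_part Q" "lhs a \<noteq> rhs a"
    and dual: "\<And>k e. (\<And>p. p \<in> binary_part Q \<Longrightarrow> lhs p = rhs p \<Longrightarrow> k \<bullet> p = e) \<Longrightarrow>
        \<exists>\<mu>. \<forall>p\<in>binary_part Q. k \<bullet> p - e = \<mu> * (rhs p - lhs p)"
  shows "facet_defining Q lhs rhs"
proof -
  let ?B = "binary_part Q" and ?F = "{p \<in> binary_part Q. lhs p = rhs p}"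
  \<comment> \<open>The face and one point \<open>a\<close> off it span everything: a functional
    constant on both is a multiple of the slack, and the slack at \<open>a\<close> is
    nonzero.\<close>
  have "?B \<subseteq> affine hull (insert a ?F)"
  proof (rule subset_affine_hull_dual)
    fix k e p
    assume k: "\<And>p. p \<in> insert a ?F \<Longrightarrow> k \<bullet> p = e" and p: "p \<in> ?B"
    obtain \<mu> where \<mu>: "\<forall>p\<in>?B. k \<bullet> p - e = \<mu> * (rhs p - lhs p)"
      using dual[of k e] k by blast
    have "k \<bullet> a = e" using k by blast
    with \<mu> a have "\<mu> = 0" by auto
    with \<mu> p show "k \<bullet> p = e" by simp
  qed simp
  moreover have "insert a ?F \<subseteq> ?B" using a by blast
  ultimately have "aff_dim (insert a ?F) = aff_dim ?B"
    using aff_dim_subset[of ?B "affine hull (insert a ?F)"] aff_dim_subset[of "insert a ?F" ?B]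
    by simp
  \<comment> \<open>The hull of the face stays in the zero set of the slack, which misses
    \<open>a\<close>; hence \<open>a\<close> adds exactly one dimension.\<close>
  moreover have "affine hull ?F \<subseteq> {p. rhs p - lhs p = 0}"
  proof (rule hull_minimal)
    show "affine {p. rhs p - lhs p = 0}"
      by (rule affine_zero_set[OF affine_functional_diff[OF rhs lhs]])
  qed auto
  then have "a \<notin> affine hull ?F" using a by auto
  ultimately have "aff_dim ?F = aff_dim ?B - 1" by (simp add: aff_dim_insert)
  then show ?thesis
    using valid by (auto simp: facet_defining_def valid_inequality_def)
qed

text \<open>A short move from \<open>u\<close> towards \<open>x\<close> keeps \<open>f\<close>
  nonnegative. So \<open>h\<close> vanishes at two distinct parameters of the segment and, being
  affine, also at \<open>x\<close>.\<close>

lemma affine_vanish_on_convex: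
  assumes "affine_functional f" "affine_functional h" "convex C"
    and u: "u \<in> C" "f u > 0"
    and vanish: "\<And>x. x \<in> C \<Longrightarrow> f x \<ge> 0 \<Longrightarrow> h x = 0"
    and x: "x \<in> C"
  shows "h x = 0"
proof -
  \<comment> \<open>Small enough that even the decrease \<open>\<bar>f x\<bar>\<close> cannot make
    \<open>f\<close> negative at parameter \<open>t\<close>.\<close>
  define t where "t = f u / (f u + \<bar>f x\<bar>)"
  have t: "0 < t" "t \<le> 1" using u by (auto simp: t_def)
  have pos: "f u + \<bar>f x\<bar> > 0" using u by simp
  have "(1 - t) * f u + t * f x = f u * (\<bar>f x\<bar> + f x) / (f u + \<bar>f x\<bar>)"
  proof -
    have "1 - t = \<bar>f x\<bar> / (f u + \<bar>f x\<bar>)" using pos by (simp add: t_def field_simps)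
    then have "(1 - t) * f u + t * f x =
        \<bar>f x\<bar> * f u / (f u + \<bar>f x\<bar>) + f u * f x / (f u + \<bar>f x\<bar>)"
      by (simp add: t_def)
    then show ?thesis by (simp only: distrib_left mult.commute[of "\<bar>f x\<bar>"] add_divide_distrib)
  qed
  also have "\<dots> \<ge> 0" using u pos by (auto intro!: divide_nonneg_nonneg mult_nonneg_nonneg)
  finally have "f ((1 - t) *\<^sub>R u + t *\<^sub>R x) \<ge> 0"
    using assms(1) by (simp add: affine_functional_convex_combination)
  moreover have "(1 - t) *\<^sub>R u + t *\<^sub>R x \<in> C"
    using assms(3) u x t by (auto intro: convexD)
  ultimately have "(1 - t) * h u + t * h x = 0"
    using vanish affine_functional_convex_combination[OF assms(2)] by metis
  moreover have "h u = 0" using u by (auto intro: vanish)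
  ultimately show ?thesis using t by simp
qed

text \<open>Every index contributes \<open>\<alpha> * w i * x i\<close> whether or not it lies in
  \<open>I\<close>. Splitting this off leaves a sum in which \<open>I\<close> makes an independent
  choice for each index.\<close>

lemma family_rhs_eq:
  assumes "finite N" "I \<subseteq> N"
  shows "family_rhs N \<alpha> w b L U I x z = \<alpha> * ((\<Sum>i\<in>N. w i * x i) + b) + (1 - \<alpha>) * (b * z +
    (\<Sum>i\<in>N. if i \<in> I then w i * (x i - breve_L w L U i * (1 - z)) else w i * breve_U w L U i * z))"
proof -
  have split: "sum g N = sum g I + sum g (N - I)" for g :: "'a \<Rightarrow> real"
    using assms by (metis add.commute sum.subset_diff)
  have if_eq: "(\<Sum>i\<in>N. if i \<in> I then g i else h i) = sum g I + sum h (N - I)"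
    for g h :: "'a \<Rightarrow> real"
    unfolding split by (intro arg_cong2[where f = "(+)"] sum.cong) auto
  show ?thesis
    unfolding family_rhs_def if_eq split[of "\<lambda>i. w i * x i"]
    by (simp add: algebra_simps sum.distrib sum_subtractf sum_distrib_left sum_distrib_right)
qed

section \<open>The polyhedra\<close>

locale leaky_neuron =
  fixes \<alpha> b :: real and w L U :: "real^'n"
  assumes \<alpha>_less_1: "\<alpha> < 1"
    and pos_value: "\<exists>x \<in> cbox L U. aff w b x > 0"
    and neg_value: "\<exists>x \<in> cbox L U. aff w b x < 0"
begin

abbreviation f :: "real^'n \<Rightarrow> real" where "f \<equiv> aff w b"

definition lower :: "real^'n" where "lower = (\<chi> i. breve_L (($) w) (($) L) (($) U) i)"
definition upper :: "real^'n" where "upper = (\<chi> i. breve_U (($) w) (($) L) (($) U) i)"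
definition mix :: "'n set \<Rightarrow> real^'n \<Rightarrow> real^'n \<Rightarrow> real^'n" where
  "mix I x y = (\<chi> i. if i \<in> I then x $ i else y $ i)"

definition rhs :: "'n set \<Rightarrow> real^'n \<Rightarrow> real \<Rightarrow> real" where
  "rhs I = (\<lambda>x z. family_rhs UNIV \<alpha> (($) w) b (($) L) (($) U) I (($) x) z)"

section \<open>Extreme values and a zero of \<open>f\<close> on the box\<close>

lemma box_nonempty: "L $ i \<le> U $ i"
proof -
  obtain x where "x \<in> cbox L U" using pos_value by blast
  then have "L $ i \<le> x $ i" "x $ i \<le> U $ i" by (auto simp: mem_box_cart)
  then show ?thesis by simp
qed

lemma mem_box_breve:
  "x \<in> cbox L U \<longleftrightarrow> (\<forall>i. if w $ i \<ge> 0 then lower $ i \<le> x $ i \<and> x $ i \<le> upper $ i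
      else upper $ i \<le> x $ i \<and> x $ i \<le> lower $ i)"
  by (auto simp: mem_box_cart lower_def upper_def breve_L_def breve_U_def)

lemma lower_in_box: "lower \<in> cbox L U" and upper_in_box: "upper \<in> cbox L U"
  using box_nonempty by (auto simp: mem_box_cart lower_def upper_def breve_L_def breve_U_def)

lemma mix_in_box: "x \<in> cbox L U \<Longrightarrow> y \<in> cbox L U \<Longrightarrow> mix I x y \<in> cbox L U"
  by (auto simp: mem_box_cart mix_def)

lemma f_mono:
  assumes "\<And>i. w $ i * x $ i \<le> w $ i * y $ i"
  shows "f x \<le> f y"
  using assms by (simp add: aff_def inner_vec_def sum_mono)

lemma breve_bounds:
  assumes "x \<in> cbox L U"
  shows "w $ i * lower $ i \<le> w $ i * x $ i" "w $ i * x $ i \<le> w $ i * upper $ i"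
  using assms unfolding mem_box_breve
  by (smt (verit) mult_left_mono mult_left_mono_neg)+

lemma Mplus_eq: "Mplus w b L U = f upper"
  unfolding Mplus_def
  by (rule cSup_eq_maximum) (auto intro!: f_mono breve_bounds imageI upper_in_box)

lemma Mminus_eq: "Mminus w b L U = f lower"
  unfolding Mminus_def
  by (rule cInf_eq_minimum) (auto intro!: f_mono breve_bounds imageI lower_in_box)

lemma f_upper_pos: "f upper > 0"
  using pos_value f_mono[OF breve_bounds(2)] by (meson less_le_trans)

lemma f_lower_neg: "f lower < 0"
  using neg_value f_mono[OF breve_bounds(1)] by (meson le_less_trans)

text \<open>The zero is found on the segment from \<open>lower\<close> to \<open>upper\<close>. It
  is where the two branches meet, so that it carries binary points with both values of
  \<open>z\<close>.\<close>

lemma f_root: "\<exists>x\<in>cbox L U. f x = 0"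
proof -
  have "f ((1 - t) *\<^sub>R lower + t *\<^sub>R upper) = (1 - t) * f lower + t * f upper" for t
    by (simp add: aff_def algebra_simps)
  moreover define t where "t = - f lower / (f upper - f lower)"
  have "(1 - t) * f lower + t * f upper = 0"
    using f_upper_pos f_lower_neg by (simp add: t_def field_simps)
  moreover have "0 \<le> t" "t \<le> 1"
    using f_upper_pos f_lower_neg by (auto simp: t_def field_simps)
  then have "(1 - t) *\<^sub>R lower + t *\<^sub>R upper \<in> cbox L U"
    using lower_in_box upper_in_box by (auto intro: convexD[OF convex_box(1)])
  ultimately show ?thesis by metis
qed

section \<open>The upper bounds in vector form\<close>

lemma rhs_eq:
  "rhs I x z = \<alpha> * f x + (1 - \<alpha>) * (b * z + w \<bullet> mix I (x - (1 - z) *\<^sub>R lower) (z *\<^sub>R upper))"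
  unfolding rhs_def by (subst family_rhs_eq)
    (auto simp: aff_def inner_vec_def mix_def lower_def upper_def mult_ac
      intro!: sum.cong arg_cong[where f = "\<lambda>s. (1 - \<alpha>) * (b * z + s)"])

text \<open>At binary \<open>z\<close> the bounds involve \<open>f\<close> only at \<open>x\<close>
  and at one mixed point. Validity and tightness on the graph thus become comparisons of these two
  values.\<close>

lemma rhs_1: "rhs I x 1 = \<alpha> * f x + (1 - \<alpha>) * f (mix I x upper)"
  by (simp add: rhs_eq aff_def algebra_simps)

lemma rhs_0: "rhs I x 0 = \<alpha> * f x + (1 - \<alpha>) * (f x - f (mix I lower x))"
proof -
  have "mix I (x - lower) 0 = x - mix I lower x" by (simp add: mix_def vec_eq_iff)
  then show ?thesis by (simp add: rhs_eq aff_def inner_diff_right)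
qed

lemma mix_simps: "mix UNIV x y = x" "mix {} x y = y"
  by (simp_all add: mix_def)

lemma bigM_lower_eq: "bigM_lower \<alpha> w b L U x z = rhs UNIV x z"
  by (simp add: bigM_lower_def Mminus_eq rhs_eq mix_simps aff_def algebra_simps)

lemma bigM_upper_eq: "bigM_upper \<alpha> w b L U x z = rhs {} x z"
  by (simp add: bigM_upper_def Mplus_eq rhs_eq mix_simps aff_def algebra_simps)

lemma ideal_polyhedron_eq:
  "ideal_polyhedron \<alpha> w b L U = {(x, y, z). f x \<le> y \<and> \<alpha> * f x \<le> y \<and> x \<in> cbox L U \<and>
     0 \<le> z \<and> z \<le> 1 \<and> (\<forall>I. y \<le> rhs I x z)}"
  by (auto simp: ideal_polyhedron_def bigM_polyhedron_def bigM_lower_eq bigM_upper_eq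
      simp flip: rhs_def[THEN fun_cong, THEN fun_cong])

lemma bigM_polyhedron_eq:
  "bigM_polyhedron \<alpha> w b L U = {(x, y, z). f x \<le> y \<and> \<alpha> * f x \<le> y \<and> y \<le> rhs UNIV x z \<and>
     y \<le> rhs {} x z \<and> x \<in> cbox L U \<and> 0 \<le> z \<and> z \<le> 1}"
  by (auto simp: bigM_polyhedron_def bigM_lower_eq bigM_upper_eq)

section \<open>Binary points of the two relaxations\<close>

definition leaky_binary :: "((real^'n) \<times> real \<times> real) set" where
  "leaky_binary = {(x, y, z). x \<in> cbox L U \<and>
     (z = 1 \<and> f x \<ge> 0 \<and> y = f x \<or> z = 0 \<and> f x \<le> 0 \<and> y = \<alpha> * f x)}"

lemma f_mix_upper: "x \<in> cbox L U \<Longrightarrow> f x \<le> f (mix I x upper)"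
  by (rule f_mono) (auto simp: mix_def breve_bounds)

lemma f_mix_lower: "x \<in> cbox L U \<Longrightarrow> f (mix I lower x) \<le> f x"
  by (rule f_mono) (auto simp: mix_def breve_bounds)

lemma scale_le_iff: "\<alpha> * t \<le> t \<longleftrightarrow> 0 \<le> t" "t \<le> \<alpha> * t \<longleftrightarrow> t \<le> 0"
proof -
  have "t - \<alpha> * t = (1 - \<alpha>) * t" by (simp add: algebra_simps)
  then show "\<alpha> * t \<le> t \<longleftrightarrow> 0 \<le> t" "t \<le> \<alpha> * t \<longleftrightarrow> t \<le> 0"
    using \<alpha>_less_1 zero_le_mult_iff[of "1 - \<alpha>" t] mult_le_0_iff[of "1 - \<alpha>" t] by linarith+
qed

lemma leaky_binary_rhs:
  assumes "(x, y, z) \<in> leaky_binary"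
  shows "y \<le> rhs I x z"
proof -
  have x: "x \<in> cbox L U" using assms by (simp add: leaky_binary_def)
  have "(1 - \<alpha>) * f x \<le> (1 - \<alpha>) * f (mix I x upper)"
    "0 \<le> (1 - \<alpha>) * (f x - f (mix I lower x))"
    using f_mix_upper[OF x, of I] f_mix_lower[OF x, of I] \<alpha>_less_1
    by (auto intro: mult_left_mono)
  then show ?thesis
    using assms by (auto simp: leaky_binary_def rhs_1 rhs_0 left_diff_distrib)
qed

lemma leaky_binary_subset_ideal: "leaky_binary \<subseteq> ideal_polyhedron \<alpha> w b L U"
proof clarify
  fix x y z assume *: "(x, y, z) \<in> leaky_binary"
  then show "(x, y, z) \<in> ideal_polyhedron \<alpha> w b L U"
    using leaky_binary_rhs[OF *] unfolding ideal_polyhedron_eq leaky_binary_def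
    by (auto simp: scale_le_iff)
qed

text \<open>At \<open>z = 1\<close> the bound for \<open>UNIV\<close> equals \<open>f x\<close>, at
  \<open>z = 0\<close> the bound for \<open>{}\<close> equals \<open>\<alpha> * f x\<close>. The
  lower bounds on \<open>y\<close> then fix \<open>y\<close> and the sign of
  \<open>f x\<close>.\<close>

lemma binary_part_bigM_subset: "binary_part (bigM_polyhedron \<alpha> w b L U) \<subseteq> leaky_binary"
proof clarify
  fix x y z assume "(x, y, z) \<in> binary_part (bigM_polyhedron \<alpha> w b L U)"
  then have p: "(x, y, z) \<in> bigM_polyhedron \<alpha> w b L U" "z \<in> {0, 1}"
    by (auto simp: binary_part_def binary_def)
  then show "(x, y, z) \<in> leaky_binary"
    by (auto simp: bigM_polyhedron_eq leaky_binary_def rhs_1 rhs_0 mix_simps left_diff_distrib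
        scale_le_iff intro: order_antisym)
qed

text \<open>A cycle of inclusions: \<open>leaky_binary\<close> lies in the binary part of the
  smaller polyhedron, which lies in that of the larger one, which lies in
  \<open>leaky_binary\<close>.\<close>

lemma binary_part_eq:
  "binary_part (bigM_polyhedron \<alpha> w b L U) = leaky_binary"
  "binary_part (ideal_polyhedron \<alpha> w b L U) = leaky_binary"
proof -
  have "leaky_binary \<subseteq> binary_part (ideal_polyhedron \<alpha> w b L U)"
    using leaky_binary_subset_ideal
    by (auto simp: binary_part_def binary_def leaky_binary_def)
  moreover have "binary_part (ideal_polyhedron \<alpha> w b L U) \<subseteq> binary_part (bigM_polyhedron \<alpha> w b L U)"
    by (auto simp: binary_part_def ideal_polyhedron_def)
  ultimately show "binary_part (bigM_polyhedron \<alpha> w b L U) = leaky_binary"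
    "binary_part (ideal_polyhedron \<alpha> w b L U) = leaky_binary"
    using binary_part_bigM_subset by blast+
qed

lemma leaky_graph_eq: "leaky_graph \<alpha> w b L U = {(x, y). \<exists>z. (x, y, z) \<in> leaky_binary}"
proof -
  have "y = max (\<alpha> * f x) (f x) \<longleftrightarrow> f x \<ge> 0 \<and> y = f x \<or> f x \<le> 0 \<and> y = \<alpha> * f x" for x y
    using scale_le_iff[of "f x"] by (auto simp: max_def)
  then show ?thesis by (auto simp: leaky_graph_def leaky_binary_def)
qed

section \<open>Polyhedrality and validity of the formulations\<close>

lemma affine_functional_coords:
  "affine_functional (\<lambda>p::(real^'n) \<times> real \<times> real. fst p $ i)"
  "affine_functional (\<lambda>p::(real^'n) \<times> real \<times> real. fst (snd p))"
  "affine_functional (\<lambda>p::(real^'n) \<times> real \<times> real. snd (snd p))"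
  "affine_functional (\<lambda>p::(real^'n) \<times> real \<times> real. f (fst p))"
proof -
  show "affine_functional (\<lambda>p::(real^'n) \<times> real \<times> real. fst p $ i)"
    using affine_functional_inner[of "(axis i 1 :: real^'n, 0::real, 0::real)"]
    by (simp add: inner_prod_def inner_axis')
  show "affine_functional (\<lambda>p::(real^'n) \<times> real \<times> real. fst (snd p))"
    using affine_functional_inner[of "(0::real^'n, 1::real, 0::real)"] by (simp add: inner_prod_def)
  show "affine_functional (\<lambda>p::(real^'n) \<times> real \<times> real. snd (snd p))"
    using affine_functional_inner[of "(0::real^'n, 0::real, 1::real)"] by (simp add: inner_prod_def)
  show "affine_functional (\<lambda>p::(real^'n) \<times> real \<times> real. f (fst p))"
    using affine_functional_add[OF affine_functional_inner[of "(w, 0::real, 0::real)"] affine_functional_const]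
    by (simp add: inner_prod_def aff_def)
qed

lemma affine_functional_rhs:
  "affine_functional (\<lambda>p::(real^'n) \<times> real \<times> real. rhs I (fst p) (snd (snd p)))"
  unfolding rhs_def family_rhs_def
  by (intro affine_functional_intros affine_functional_coords)

lemma polyhedron_bigM: "polyhedron (bigM_polyhedron \<alpha> w b L U)"
proof -
  have eq: "bigM_polyhedron \<alpha> w b L U = {p. f (fst p) \<le> fst (snd p) \<and> \<alpha> * f (fst p) \<le> fst (snd p) \<and>
      fst (snd p) \<le> rhs UNIV (fst p) (snd (snd p)) \<and> fst (snd p) \<le> rhs {} (fst p) (snd (snd p)) \<and>
      (\<forall>i\<in>UNIV. L $ i \<le> fst p $ i) \<and> (\<forall>i\<in>UNIV. fst p $ i \<le> U $ i) \<and>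
      0 \<le> snd (snd p) \<and> snd (snd p) \<le> 1}"
    unfolding bigM_polyhedron_eq by (auto simp: mem_box_cart)
  show ?thesis unfolding eq
    by (intro polyhedron_Collect_conj polyhedron_Collect_le polyhedron_Collect_ball
      affine_functional_rhs affine_functional_intros affine_functional_coords finite)
qed

lemma polyhedron_ideal: "polyhedron (ideal_polyhedron \<alpha> w b L U)"
proof -
  have "{(x, y, z). \<forall>I \<subseteq> UNIV. y \<le> family_rhs UNIV \<alpha> (($) w) b (($) L) (($) U) I (($) x) z}
      = {p. \<forall>I\<in>UNIV. fst (snd p) \<le> rhs I (fst p) (snd (snd p))}"
    by (auto simp: rhs_def)
  moreover have "polyhedron \<dots>"
    by (intro polyhedron_Collect_ball polyhedron_Collect_le affine_functional_rhs
      affine_functional_coords finite)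
  ultimately show ?thesis
    unfolding ideal_polyhedron_def using polyhedron_bigM by (simp add: polyhedron_Int)
qed

lemma mip_formulations:
  "mip_formulation (bigM_polyhedron \<alpha> w b L U) (leaky_graph \<alpha> w b L U)"
  "mip_formulation (ideal_polyhedron \<alpha> w b L U) (leaky_graph \<alpha> w b L U)"
  by (simp_all add: mip_formulation_def polyhedron_bigM polyhedron_ideal leaky_graph_eq
      binary_part_eq)

section \<open>Integrality of the extreme points\<close>

lemma f_convex_combination: "f ((1 - t) *\<^sub>R x + t *\<^sub>R y) = (1 - t) * f x + t * f y"
  by (simp add: aff_def algebra_simps)

text \<open>Moving from \<open>x\<close> towards the split \<open>(a0, a1)\<close> that is tight for the inequality of the
  family given by \<open>I\<close>, the value at \<open>x1\<close> passes through every admissible one.\<close>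

lemma ideal_polyhedron_decomposition:
  assumes p: "(x, y, z) \<in> ideal_polyhedron \<alpha> w b L U" and z: "0 < z" "z < 1"
  obtains x0 x1 where
    "(x0, \<alpha> * f x0, 0) \<in> leaky_binary" "(x1, f x1, 1) \<in> leaky_binary"
    "x = (1 - z) *\<^sub>R x0 + z *\<^sub>R x1" "y = (1 - z) * (\<alpha> * f x0) + z * f x1"
proof -
  have x: "x \<in> cbox L U" and y: "f x \<le> y" "\<alpha> * f x \<le> y" and fam: "\<And>I. y \<le> rhs I x z"
    using p by (auto simp: ideal_polyhedron_eq)
  define s where "s = (y - \<alpha> * f x) / (1 - \<alpha>)"
  have ys: "y = \<alpha> * f x + (1 - \<alpha>) * s" using \<alpha>_less_1 by (simp add: s_def)
  have s0: "0 \<le> s" using y \<alpha>_less_1 by (simp add: s_def)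
  have "(1 - \<alpha>) * f x \<le> (1 - \<alpha>) * s" using y ys by (simp add: algebra_simps)
  then have sf: "f x \<le> s" using \<alpha>_less_1 by simp
  \<comment> \<open>In each coordinate \<open>I\<close> picks the term with the smaller product with
    \<open>w $ i\<close>. With this choice \<open>u\<close> respects the bound
    \<open>z * upper\<close> and \<open>x - u\<close> the bound \<open>(1 - z) * lower\<close> at
    the same time.\<close>
  define I where "I = {i. if w $ i \<ge> 0 then x $ i - (1 - z) * lower $ i \<le> z * upper $ i
    else x $ i - (1 - z) * lower $ i \<ge> z * upper $ i}"
  define u where "u = mix I (x - (1 - z) *\<^sub>R lower) (z *\<^sub>R upper)"
  define a1 where "a1 = (1 / z) *\<^sub>R u"
  define a0 where "a0 = (1 / (1 - z)) *\<^sub>R (x - u)"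
  \<comment> \<open>That is, \<open>u\<close> lies in the box scaled by \<open>z\<close> and
    \<open>x - u\<close> in the box scaled by \<open>1 - z\<close>.\<close>
  have bounds: "if w $ i \<ge> 0
      then z * lower $ i \<le> u $ i \<and> u $ i \<le> z * upper $ i \<and>
        (1 - z) * lower $ i \<le> x $ i - u $ i \<and> x $ i - u $ i \<le> (1 - z) * upper $ i
      else z * upper $ i \<le> u $ i \<and> u $ i \<le> z * lower $ i \<and>
        (1 - z) * upper $ i \<le> x $ i - u $ i \<and> x $ i - u $ i \<le> (1 - z) * lower $ i" for i
  proof -
    have ui: "u $ i = (if i \<in> I then x $ i - (1 - z) * lower $ i else z * upper $ i)"
      by (simp add: u_def mix_def)
    have xi: "if w $ i \<ge> 0 then lower $ i \<le> x $ i \<and> x $ i \<le> upper $ i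
      else upper $ i \<le> x $ i \<and> x $ i \<le> lower $ i"
      using x by (simp add: mem_box_breve)
    show ?thesis
    proof (cases "w $ i \<ge> 0")
      case True
      then have "lower $ i \<le> upper $ i" using xi by simp
      then have "z * lower $ i \<le> z * upper $ i" "(1 - z) * lower $ i \<le> (1 - z) * upper $ i"
        using z by (auto intro: mult_left_mono)
      then show ?thesis using True xi by (auto simp: ui I_def algebra_simps)
    next
      case False
      then have "upper $ i \<le> lower $ i" using xi by simp
      then have "z * upper $ i \<le> z * lower $ i" "(1 - z) * upper $ i \<le> (1 - z) * lower $ i"
        using z by (auto intro: mult_left_mono)
      then show ?thesis using False xi by (auto simp: ui I_def algebra_simps)
    qed
  qed
  have a1: "a1 \<in> cbox L U"
    using bounds z by (auto simp: mem_box_breve a1_def field_simps split: if_splits)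
  have a0: "a0 \<in> cbox L U"
    using bounds z by (auto simp: mem_box_breve a0_def pos_le_divide_eq pos_divide_le_eq mult.commute
        split: if_splits)
  have split: "(1 - z) *\<^sub>R a0 + z *\<^sub>R a1 = x" using z by (simp add: a0_def a1_def)
  have "(1 - \<alpha>) * s \<le> (1 - \<alpha>) * (b * z + w \<bullet> u)"
    using fam[of I] ys by (simp add: rhs_eq u_def)
  then have "s \<le> b * z + w \<bullet> u" using \<alpha>_less_1 by simp
  then have "s / z \<le> f a1" using z by (simp add: a1_def aff_def field_simps)
  moreover have "f x * z \<le> s"
  proof (cases "f x \<ge> 0")
    case True
    then have "f x * z \<le> f x" using z by (simp add: mult_left_le)
    then show ?thesis using sf by simp
  next
    case False
    then have "f x * z \<le> 0" using z by (simp add: mult_nonpos_nonneg)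
    then show ?thesis using s0 by simp
  qed
  then have "f x \<le> s / z" using z by (simp add: field_simps)
  \<comment> \<open>The value to be hit is \<open>s / z\<close>, because the split needs
    \<open>z * f x1 = s\<close>.\<close>
  ultimately have "s / z \<in> closed_segment (f x) (f a1)"
    by (simp add: closed_segment_eq_real_ivl)
  then obtain t where t: "0 \<le> t" "t \<le> 1" "s / z = (1 - t) * f x + t * f a1"
    by (auto simp: in_segment)
  define x1 where "x1 = (1 - t) *\<^sub>R x + t *\<^sub>R a1"
  define x0 where "x0 = (1 - t) *\<^sub>R x + t *\<^sub>R a0"
  have box: "x1 \<in> cbox L U" "x0 \<in> cbox L U"
    unfolding x1_def x0_def using t x a1 a0 by (auto intro!: convexD[OF convex_box(1)])
  have x_eq: "x = (1 - z) *\<^sub>R x0 + z *\<^sub>R x1"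
  proof -
    have "(1 - z) *\<^sub>R x0 + z *\<^sub>R x1 = (1 - t) *\<^sub>R x + t *\<^sub>R ((1 - z) *\<^sub>R a0 + z *\<^sub>R a1)"
      by (simp add: x0_def x1_def algebra_simps)
    also have "\<dots> = x" unfolding split by (simp add: algebra_simps)
    finally show ?thesis by simp
  qed
  have f1: "z * f x1 = s" using t z by (simp add: x1_def f_convex_combination flip: t(3))
  \<comment> \<open>The signs required at the two endpoints now follow from
    \<open>f x \<le> s\<close> and \<open>0 \<le> s\<close>.\<close>
  have f0: "(1 - z) * f x0 = f x - s"
    using f_convex_combination[of z x0 x1] f1 by (simp flip: x_eq)
  show ?thesis
  proof
    show "(x0, \<alpha> * f x0, 0) \<in> leaky_binary"
      using f0 sf z box by (simp add: leaky_binary_def) (smt (verit) mult_pos_pos)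
    show "(x1, f x1, 1) \<in> leaky_binary"
      using f1 s0 z box by (simp add: leaky_binary_def) (smt (verit) mult_pos_neg)
    have "(1 - z) * (\<alpha> * f x0) = \<alpha> * (f x - s)" unfolding f0[symmetric] by simp
    then show "y = (1 - z) * (\<alpha> * f x0) + z * f x1" by (simp add: ys f1 algebra_simps)
  qed (fact x_eq)
qed

text \<open>A fractional extreme point would lie strictly between the two points of its
  decomposition, which differ in \<open>z\<close>.\<close>

lemma ideal: "ideal_formulation (ideal_polyhedron \<alpha> w b L U) (leaky_graph \<alpha> w b L U)"
proof -
  let ?Q = "ideal_polyhedron \<alpha> w b L U"
  have "z \<in> {0, 1}" if ext: "(x, y, z) extreme_point_of ?Q" for x y z
  proof (rule ccontr)
    assume "z \<notin> {0, 1}"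
    moreover have p: "(x, y, z) \<in> ?Q" using ext by (simp add: extreme_point_of_def)
    ultimately have z: "0 < z" "z < 1" by (auto simp: ideal_polyhedron_eq)
    obtain x0 x1 where q: "(x0, \<alpha> * f x0, 0) \<in> leaky_binary" "(x1, f x1, 1) \<in> leaky_binary"
      and eq: "x = (1 - z) *\<^sub>R x0 + z *\<^sub>R x1" "y = (1 - z) * (\<alpha> * f x0) + z * f x1"
      using ideal_polyhedron_decomposition[OF p z] by blast
    have "(x, y, z) \<in> open_segment (x0, \<alpha> * f x0, 0) (x1, f x1, 1)"
      unfolding in_segment using z eq by (auto intro!: exI[of _ z])
    then show False
      using ext q leaky_binary_subset_ideal unfolding extreme_point_of_def by blast
  qed
  then show ?thesis
    by (auto simp: ideal_formulation_def mip_formulations binary_def)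
qed

section \<open>Facets\<close>

text \<open>Each face contains one whole branch. A functional constant on the face therefore
  satisfies an affine identity on that half of the box, hence on all of it. The zero of
  \<open>f\<close>, taken with both values of \<open>z\<close>, removes the coefficient of
  \<open>z\<close>, and the multiplier is the coefficient of \<open>y\<close>.\<close>

lemma slope_below_facet:
  assumes Q: "binary_part Q = leaky_binary"
  shows "facet_defining Q (\<lambda>(x, y, z). f x) (\<lambda>(x, y, z). y)" (is ?A)
    and "facet_defining Q (\<lambda>(x, y, z). \<alpha> * f x) (\<lambda>(x, y, z). y)" (is ?B)
proof -
  obtain r where r: "r \<in> cbox L U" "f r = 0" using f_root by blast
  have mem: "(r, 0, 0) \<in> leaky_binary" "(r, 0, 1) \<in> leaky_binary"
    "(upper, f upper, 1) \<in> leaky_binary" "(lower, \<alpha> * f lower, 0) \<in> leaky_binary"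
    using r f_upper_pos f_lower_neg upper_in_box lower_in_box by (auto simp: leaky_binary_def)
  have ne: "f upper \<noteq> \<alpha> * f upper" "f lower \<noteq> \<alpha> * f lower"
    using f_upper_pos f_lower_neg \<alpha>_less_1 by auto
  have aff: "affine_functional (\<lambda>x. k \<bullet> x + c * f x + d)" for k c d
    unfolding aff_def
    by (intro affine_functional_intros affine_functional_inner)
  have aff_f: "affine_functional f" "affine_functional (\<lambda>x. - 1 * f x)"
    unfolding aff_def
    by (intro affine_functional_intros affine_functional_inner)+
  show ?A
    unfolding case_prod_beta
  proof (rule facet_defining_dual[where a = "(lower, \<alpha> * f lower, 0)" and ?p0.0 = "(r, 0, 0)"], unfold Q)
    fix k e
    assume van: "\<And>p. p \<in> leaky_binary \<Longrightarrow> f (fst p) = fst (snd p) \<Longrightarrow> k \<bullet> p = e"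
    obtain k1 c d where k: "k = (k1, c, d)" by (cases k)
    have eq: "k1 \<bullet> x + c * f x + (d - e) = 0" if "x \<in> cbox L U" for x
    proof (rule affine_vanish_on_convex[OF aff_f(1) aff convex_box(1) upper_in_box f_upper_pos _ that])
      fix x assume "x \<in> cbox L U" "0 \<le> f x"
      then show "k1 \<bullet> x + c * f x + (d - e) = 0"
        using van[of "(x, f x, 1)"] by (simp add: leaky_binary_def k algebra_simps)
    qed
    have "d = 0"
      using van[OF mem(1)] eq[of r] r by (simp add: k)
    then have "k \<bullet> (x, y, z) - e = c * (y - f x)" if "(x, y, z) \<in> leaky_binary" for x y z
      using that eq[of x] by (auto simp: leaky_binary_def k algebra_simps)
    then have "\<forall>p\<in>leaky_binary. k \<bullet> p - e = c * (fst (snd p) - f (fst p))"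
      by (metis prod.collapse)
    then show "\<exists>\<mu>. \<forall>p\<in>leaky_binary. k \<bullet> p - e = \<mu> * (fst (snd p) - f (fst p))" by blast
  qed (use mem ne r in \<open>auto simp: leaky_binary_def scale_le_iff intro!: affine_functional_coords\<close>)
  show ?B
    unfolding case_prod_beta
  proof (rule facet_defining_dual[where a = "(upper, f upper, 1)" and ?p0.0 = "(r, 0, 1)"], unfold Q)
    fix k e
    assume van: "\<And>p. p \<in> leaky_binary \<Longrightarrow> \<alpha> * f (fst p) = fst (snd p) \<Longrightarrow> k \<bullet> p = e"
    obtain k1 c d where k: "k = (k1, c, d)" by (cases k)
    have eq: "k1 \<bullet> x + (c * \<alpha>) * f x + (- e) = 0" if "x \<in> cbox L U" for x
    \<comment> \<open>Here the branch in the face is \<open>f x \<le> 0\<close>, so the extension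
      argument uses \<open>- f\<close>.\<close>
    proof (rule affine_vanish_on_convex[OF aff_f(2) aff convex_box(1) lower_in_box _ _ that])
      show "0 < - 1 * f lower" using f_lower_neg by simp
      fix x assume "x \<in> cbox L U" "0 \<le> - 1 * f x"
      then show "k1 \<bullet> x + (c * \<alpha>) * f x + (- e) = 0"
        using van[of "(x, \<alpha> * f x, 0)"] by (simp add: leaky_binary_def k algebra_simps)
    qed
    have "d = 0"
      using van[OF mem(2)] eq[of r] r by (simp add: k)
    then have "k \<bullet> (x, y, z) - e = c * (y - \<alpha> * f x)" if "(x, y, z) \<in> leaky_binary" for x y z
      using that eq[of x] by (auto simp: leaky_binary_def k algebra_simps)
    then have "\<forall>p\<in>leaky_binary. k \<bullet> p - e = c * (fst (snd p) - \<alpha> * f (fst p))"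
      by (metis prod.collapse)
    then show "\<exists>\<mu>. \<forall>p\<in>leaky_binary. k \<bullet> p - e = \<mu> * (fst (snd p) - \<alpha> * f (fst p))" by blast
  qed (use mem ne r in \<open>auto simp: leaky_binary_def scale_le_iff
      intro!: affine_functional_coords affine_functional_scale\<close>)
qed

text \<open>For \<open>u = upper\<close> this slice of the box, where \<open>f\<close> is
  nonnegative, consists of tight points with \<open>z = 1\<close>; convexity makes
  \<open>affine_vanish_on_convex\<close> applicable.\<close>

lemma convex_mix: "convex {x \<in> cbox L U. mix I x u = x}"
proof -
  have "mix I x u = x \<longleftrightarrow> (\<forall>i. i \<notin> I \<longrightarrow> x $ i = u $ i)" for x
    by (auto simp: mix_def vec_eq_iff)
  moreover have "convex {x. \<forall>i. i \<notin> I \<longrightarrow> x $ i = u $ i}"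
    by (rule convexI) (auto, metis distrib_right mult_1)
  ultimately show ?thesis
    using convex_Int[OF convex_box(1)[of L U]] by (simp add: Collect_conj_eq)
qed

lemma mix_add_mix: "mix I x y + mix I y x = x + y"
  by (simp add: mix_def vec_eq_iff)

lemma f_mix_add: "f (mix I x y) + f (mix I y x) = f x + f y"
proof -
  have "w \<bullet> mix I x y + w \<bullet> mix I y x = w \<bullet> x + w \<bullet> y"
    by (metis inner_add_right mix_add_mix)
  then show ?thesis by (simp add: aff_def)
qed

text \<open>The corner \<open>mix I upper lower\<close> is tried first. If it is tight,
  \<open>f\<close> there equals \<open>f upper\<close> or \<open>f lower\<close>; by
  \<open>f_mix_add\<close> the opposite corner then takes the other extreme value, and the zero
  \<open>r\<close> has slack with the other value of \<open>z\<close>.\<close>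

lemma slack_point:
  obtains x y z where "(x, y, z) \<in> leaky_binary" "y \<noteq> rhs I x z"
proof -
  obtain r where r: "r \<in> cbox L U" "f r = 0" using f_root by blast
  let ?c = "mix I upper lower"
  have c: "?c \<in> cbox L U" by (simp add: mix_in_box upper_in_box lower_in_box)
  have mix_c: "mix I ?c upper = upper" "mix I lower ?c = lower"
    by (simp_all add: mix_def vec_eq_iff)
  have sum: "f (mix I lower upper) + f ?c = f lower + f upper" by (rule f_mix_add)
  have nz: "1 - \<alpha> \<noteq> 0" using \<alpha>_less_1 by simp
  have below: "f (mix I lower r) \<le> f (mix I lower upper)"
    and above: "f (mix I lower upper) \<le> f (mix I r upper)"
    using breve_bounds[OF r(1)] by (auto intro!: f_mono simp: mix_def)
  have r01: "(r, 0, 0) \<in> leaky_binary" "(r, 0, 1) \<in> leaky_binary"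
    using r by (auto simp: leaky_binary_def)
  show ?thesis
  proof (cases "f ?c \<ge> 0")
    case True
    then have "(?c, f ?c, 1) \<in> leaky_binary" using c by (simp add: leaky_binary_def)
    moreover have "rhs I ?c 1 - f ?c = (1 - \<alpha>) * (f upper - f ?c)"
      by (simp add: rhs_1 mix_c algebra_simps)
    moreover have "rhs I r 0 = - (1 - \<alpha>) * f (mix I lower r)" using r by (simp add: rhs_0 algebra_simps)
    moreover have "f (mix I lower r) \<noteq> 0" if "f ?c = f upper"
      using that sum below f_lower_neg by simp
    ultimately show ?thesis using that r01 nz by (metis eq_iff_diff_eq_0 mult_eq_0_iff neg_equal_0_iff_equal)
  next
    case False
    then have "(?c, \<alpha> * f ?c, 0) \<in> leaky_binary" using c by (simp add: leaky_binary_def)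
    moreover have "rhs I ?c 0 - \<alpha> * f ?c = (1 - \<alpha>) * (f ?c - f lower)"
      by (simp add: rhs_0 mix_c)
    moreover have "rhs I r 1 = (1 - \<alpha>) * f (mix I r upper)" using r by (simp add: rhs_1)
    moreover have "f (mix I r upper) \<noteq> 0" if "f ?c = f lower"
      using that sum above f_upper_pos by simp
    ultimately show ?thesis using that r01 nz by (metis eq_iff_diff_eq_0 mult_eq_0_iff)
  qed
qed

text \<open>A functional constant on the face has fixed values on the points agreeing with \<open>upper\<close>
  outside \<open>I\<close> (where \<open>z = 1\<close>) and on those agreeing with \<open>lower\<close> on \<open>I\<close> (where
  \<open>z = 0\<close>). Every \<open>x\<close> satisfies \<open>x + mix I lower upper = mix I x upper + mix I lower x\<close>,
  with such points in the other three places.\<close>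

lemma rhs_facet:
  assumes Q: "binary_part Q = leaky_binary"
  shows "facet_defining Q (\<lambda>(x, y, z). y) (\<lambda>(x, y, z). rhs I x z)"
proof -
  obtain xa ya za where a: "(xa, ya, za) \<in> leaky_binary" "ya \<noteq> rhs I xa za"
    by (rule slack_point)
  have mix_upper: "mix I upper upper = upper" and mix_lower: "mix I lower lower = lower"
    by (simp_all add: mix_def vec_eq_iff)
  show ?thesis
    unfolding case_prod_beta
  proof (rule facet_defining_dual[where ?p0.0 = "(upper, f upper, 1)" and a = "(xa, ya, za)"], unfold Q)
    show "fst (snd p) \<le> rhs I (fst p) (snd (snd p))" if "p \<in> leaky_binary" for p
      using that leaky_binary_rhs[of "fst p" "fst (snd p)" "snd (snd p)"] by simp
    show "(upper, f upper, 1) \<in> leaky_binary"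
      using f_upper_pos upper_in_box by (simp add: leaky_binary_def)
    show "fst (snd (upper, f upper, 1)) = rhs I (fst (upper, f upper, 1)) (snd (snd (upper, f upper, 1)))"
      by (simp add: rhs_1 mix_upper algebra_simps)
    fix k e
    assume van: "\<And>p. p \<in> leaky_binary \<Longrightarrow> fst (snd p) = rhs I (fst p) (snd (snd p)) \<Longrightarrow> k \<bullet> p = e"
    obtain k1 c d where k: "k = (k1, c, d)" by (cases k)
    have aff: "affine_functional (\<lambda>x. k1 \<bullet> x + c * f x + d)" for k1 c d
      unfolding aff_def by (intro affine_functional_intros affine_functional_inner)
    have aff_f: "affine_functional f" "affine_functional (\<lambda>x. - 1 * f x)"
      unfolding aff_def by (intro affine_functional_intros affine_functional_inner)+
    have eq1: "k1 \<bullet> x + c * f x + (d - e) = 0" if "x \<in> cbox L U" "mix I x upper = x" for x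
    proof (rule affine_vanish_on_convex[OF aff_f(1) aff convex_mix _ f_upper_pos])
      fix x assume "x \<in> {x \<in> cbox L U. mix I x upper = x}" "0 \<le> f x"
      then show "k1 \<bullet> x + c * f x + (d - e) = 0"
        using van[of "(x, f x, 1)"] by (simp add: leaky_binary_def rhs_1 k algebra_simps)
    qed (use that mix_upper upper_in_box in auto)
    \<comment> \<open>Fixing the coordinates in \<open>I\<close> is the slice of
      \<open>convex_mix\<close> for the complement.\<close>
    have compl: "mix I lower x = mix (- I) x lower" for x by (simp add: mix_def vec_eq_iff)
    have eq0: "k1 \<bullet> x + (c * \<alpha>) * f x + (- e) = 0" if "x \<in> cbox L U" "mix I lower x = x" for x
    proof (rule affine_vanish_on_convex[OF aff_f(2) aff convex_mix[of "- I" lower]])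
      show "0 < - 1 * f lower" using f_lower_neg by simp
      fix x assume "x \<in> {x \<in> cbox L U. mix (- I) x lower = x}" "0 \<le> - 1 * f x"
      then show "k1 \<bullet> x + (c * \<alpha>) * f x + (- e) = 0"
        using van[of "(x, \<alpha> * f x, 0)"] by (simp add: leaky_binary_def rhs_0 k algebra_simps flip: compl)
    qed (use that mix_lower lower_in_box in \<open>simp_all flip: compl\<close>)
    have "k \<bullet> (x, y, z) - e = - c * (rhs I x z - y)" if "(x, y, z) \<in> leaky_binary" for x y z
    proof -
      let ?x1 = "mix I x upper" and ?x0 = "mix I lower x" and ?x' = "mix I lower upper"
      have x: "x \<in> cbox L U" using that by (simp add: leaky_binary_def)
      have m: "mix I ?x1 upper = ?x1" "mix I ?x' upper = ?x'" "mix I lower ?x0 = ?x0" "mix I lower ?x' = ?x'"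
        by (simp_all add: mix_def vec_eq_iff)
      \<comment> \<open>\<open>?x'\<close> lies in both slices. Its two equations express
        \<open>d\<close> through \<open>c\<close>, which leaves the coefficient of \<open>y\<close>
        as the only freedom.\<close>
      have eqs: "k1 \<bullet> ?x1 + c * f ?x1 + (d - e) = 0" "k1 \<bullet> ?x' + c * f ?x' + (d - e) = 0"
        "k1 \<bullet> ?x0 + (c * \<alpha>) * f ?x0 + (- e) = 0" "k1 \<bullet> ?x' + (c * \<alpha>) * f ?x' + (- e) = 0"
        by (intro eq1 eq0 mix_in_box x lower_in_box upper_in_box m)+
      have "x + ?x' = ?x1 + ?x0" by (simp add: mix_def vec_eq_iff)
      then have "v \<bullet> x + v \<bullet> ?x' = v \<bullet> ?x1 + v \<bullet> ?x0" for v by (metis inner_add_right)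
      from this[of k1] this[of w]
      have par: "k1 \<bullet> x + k1 \<bullet> ?x' = k1 \<bullet> ?x1 + k1 \<bullet> ?x0" "f x + f ?x' = f ?x1 + f ?x0"
        by (simp_all add: aff_def)
      consider "z = 1" "y = f x" | "z = 0" "y = \<alpha> * f x"
        using \<open>(x, y, z) \<in> leaky_binary\<close> by (auto simp: leaky_binary_def)
      then show ?thesis
      proof cases
        case 1
        have "k1 \<bullet> x + c * f x + d - e = - c * (\<alpha> * f x + (1 - \<alpha>) * f ?x1 - f x)"
          using eqs par by algebra
        then show ?thesis by (simp add: 1 k rhs_1)
      next
        case 2
        have "k1 \<bullet> x + c * (\<alpha> * f x) - e = - c * ((1 - \<alpha>) * (f x - f ?x0))"
          using eqs par by algebra
        then show ?thesis by (simp add: 2 k rhs_0)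
      qed
    qed
    then have "\<forall>p\<in>leaky_binary. k \<bullet> p - e = - c * (rhs I (fst p) (snd (snd p)) - fst (snd p))"
      by (metis prod.collapse)
    then show "\<exists>\<mu>. \<forall>p\<in>leaky_binary. k \<bullet> p - e = \<mu> * (rhs I (fst p) (snd (snd p)) - fst (snd p))"
      by blast
  qed (use a in \<open>auto intro: affine_functional_coords affine_functional_rhs\<close>)
qed

end
section \<open>Separation in linear time\<close>

primrec loop_free :: "com \<Rightarrow> bool" where
  "loop_free Skip \<longleftrightarrow> True"
| "loop_free (Do ins) \<longleftrightarrow> True"
| "loop_free (Seq c1 c2) \<longleftrightarrow> loop_free c1 \<and> loop_free c2"
| "loop_free (Cond e c1 c2) \<longleftrightarrow> loop_free c1 \<and> loop_free c2"
| "loop_free (While e c) \<longleftrightarrow> False"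

text \<open>The values of \<open>result\<close> and \<open>cost\<close> on loops are irrelevant.\<close>

primrec result :: "com \<Rightarrow> state \<Rightarrow> state" where
  "result Skip s = s"
| "result (Do ins) s = exec ins s"
| "result (Seq c1 c2) s = result c2 (result c1 s)"
| "result (Cond e c1 c2) s = (if holds e s then result c1 s else result c2 s)"
| "result (While e c) s = s"

primrec cost :: "com \<Rightarrow> nat" where
  "cost Skip = 0"
| "cost (Do ins) = 1"
| "cost (Seq c1 c2) = cost c1 + cost c2"
| "cost (Cond e c1 c2) = 1 + max (cost c1) (cost c2)"
| "cost (While e c) = 0"

lemma runs_loop_free:
  "loop_free c \<Longrightarrow> \<exists>t\<le>cost c. runs c s t (result c s)"
proof (induction c arbitrary: s)
  case (Seq c1 c2)
  then obtain t1 t2 where "t1 \<le> cost c1" "runs c1 s t1 (result c1 s)"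
    "t2 \<le> cost c2" "runs c2 (result c1 s) t2 (result c2 (result c1 s))"
    by (metis loop_free.simps(3))
  then show ?case by (auto intro!: exI[of _ "t1 + t2"] runs_Seq)
next
  case (Cond e c1 c2)
  then obtain t1 t2 where t: "t1 \<le> cost c1" "runs c1 s t1 (result c1 s)"
    "t2 \<le> cost c2" "runs c2 s t2 (result c2 s)"
    by (metis loop_free.simps(4))
  show ?case
  proof (cases "holds e s")
    case True
    then have "runs (Cond e c1 c2) s (1 + t1) (result (Cond e c1 c2) s)"
      using t by (simp add: runs_CondTrue[simplified])
    moreover have "1 + t1 \<le> cost (Cond e c1 c2)" using t by simp
    ultimately show ?thesis by blast
  next
    case False
    then have "runs (Cond e c1 c2) s (1 + t2) (result (Cond e c1 c2) s)"
      using t by (simp add: runs_CondFalse[simplified])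
    moreover have "1 + t2 \<le> cost (Cond e c1 c2)" using t by simp
    ultimately show ?thesis by blast
  qed
next
  case (Do ins)
  show ?case using runs_Do[of ins s] by (intro exI[of _ 1]) simp
qed (auto intro: runs_Skip)

text \<open>Each remaining round pays for its test and at most \<open>cost c\<close>; the final
  \<open>1\<close> is the failing test. The induction descends from \<open>k = n\<close>.\<close>

lemma runs_counting_loop:
  assumes c: "loop_free c"
    and step: "\<And>k s. Inv k s \<Longrightarrow> k < n \<Longrightarrow> holds e s \<and> Inv (Suc k) (result c s)"
    and stop: "\<And>s. Inv n s \<Longrightarrow> \<not> holds e s"
    and "Inv k s" "k \<le> n"
  shows "\<exists>t s'. runs (While e c) s t s' \<and> t \<le> (n - k) * (cost c + 1) + 1 \<and> Inv n s'"
  using assms(5,4)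
proof (induction k arbitrary: s rule: inc_induct)
  case base
  then show ?case using runs_WhileFalse stop by fastforce
next
  case (step k)
  have e: "holds e s" "Inv (Suc k) (result c s)"
    using assms(2)[OF step.prems step.hyps(2)] by auto
  obtain t where t: "t \<le> cost c" "runs c s t (result c s)"
    using runs_loop_free[OF c] by blast
  obtain t' s' where t': "runs (While e c) (result c s) t' s'"
    "t' \<le> (n - Suc k) * (cost c + 1) + 1" "Inv n s'"
    using step.IH[OF e(2)] by blast
  have "n - k = Suc (n - Suc k)" using step.hyps by simp
  then have "1 + t + t' \<le> (n - k) * (cost c + 1) + 1" using t(1) t'(2) by simp
  then show ?case using runs_WhileTrue[OF e(1) t(2) t'(1)] t'(3) by blast
qed

section \<open>The separation program\<close>

fun block :: "com list \<Rightarrow> com" where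
  "block [] = Skip"
| "block (c # cs) = Seq c (block cs)"

text \<open>Real registers: 4 stays 0, 5 is \<open>1 - z\<close>, 6 and 7 accumulate \<open>w \<bullet> x\<close> and the sum of
  the smaller one of the two terms available for each index, 14 is 1.\<close>

definition separation_init :: com where
  "separation_init = block [Do (RConst 14 1), Do (RSub 5 14 3)]"

text \<open>Registers 8 to 11 first receive \<open>w\<close>, \<open>x\<close> and the breve bounds
  at the current index; 12 and 13 become its terms inside and outside the index set. Ties go
  inside.\<close>

definition separation_body :: com where
  "separation_body = block
    [Do (Load 8 0 1), Do (Load 9 3 1),
     Cond (RLe 4 8)
       (block [Do (Load 10 1 1), Do (Load 11 2 1)])
       (block [Do (Load 10 2 1), Do (Load 11 1 1)]),
     Do (RMul 10 10 5), Do (RSub 12 9 10), Do (RMul 12 8 12),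
     Do (RMul 13 8 11), Do (RMul 13 13 3),
     Do (RMul 9 8 9), Do (RAdd 6 6 9),
     Cond (RLe 12 13)
       (block [Do (RAdd 7 7 12), Do (Store 4 1 14)])
       (Do (RAdd 7 7 13)),
     Do (ISuc 1)]"

text \<open>Register 6 becomes the smallest right-hand side, assembled as in
  \<open>family_rhs_eq\<close>. Register 0 still holds \<open>\<alpha>\<close> until the answer
  overwrites it.\<close>

definition separation_final :: com where
  "separation_final = block
    [Do (RAdd 6 6 1), Do (RMul 6 0 6), Do (RMul 8 1 3), Do (RAdd 7 7 8),
     Do (RSub 9 14 0), Do (RMul 7 9 7), Do (RAdd 6 6 7),
     Cond (RLe 2 6) (Do (RConst 0 0)) (Do (RConst 0 1))]"

definition separation_program :: com where
  "separation_program =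
     Seq separation_init (Seq (While (ILess 1 0) separation_body) separation_final)"

lemma separation_blocks:
  "loop_free separation_init" "cost separation_init = 2"
  "loop_free separation_body" "cost separation_body = 16"
  "loop_free separation_final" "cost separation_final = 9"
  by (simp_all add: separation_init_def separation_body_def separation_final_def)

section \<open>Correctness and running time of the program\<close>

context
  fixes \<eta> :: nat and \<alpha> b y z :: real and w L U x :: "nat \<Rightarrow> real"
begin

definition term_in :: "nat \<Rightarrow> real" where
  "term_in i = w i * (x i - breve_L w L U i * (1 - z))"

definition term_out :: "nat \<Rightarrow> real" where
  "term_out i = w i * breve_U w L U i * z"

text \<open>The clause on array 4 ranges over all cells: those from \<open>k\<close> on still hold
  the initial 0, so that only selected indices need a store.\<close>

definition separation_inv :: "nat \<Rightarrow> state \<Rightarrow> bool" where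
  "separation_inv k s \<longleftrightarrow> idx s 0 = \<eta> \<and> idx s 1 = k \<and>
     reg s 0 = \<alpha> \<and> reg s 1 = b \<and> reg s 2 = y \<and> reg s 3 = z \<and> reg s 4 = 0 \<and> reg s 5 = 1 - z \<and>
     reg s 14 = 1 \<and> reg s 6 = (\<Sum>i<k. w i * x i) \<and>
     reg s 7 = (\<Sum>i<k. min (term_in i) (term_out i)) \<and>
     (\<forall>i<\<eta>. arr s 0 i = w i \<and> arr s 1 i = L i \<and> arr s 2 i = U i \<and> arr s 3 i = x i) \<and>
     (\<forall>i. arr s 4 i = (if i < k \<and> term_in i \<le> term_out i then 1 else 0))"

lemma separation_init_inv:
  "separation_inv 0 (result separation_init (input_state \<eta> \<alpha> w b L U x y z))"
  by (simp add: separation_init_def input_state_def separation_inv_def)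

lemma separation_body_inv:
  assumes "separation_inv k s" "k < \<eta>"
  shows "separation_inv (Suc k) (result separation_body s)"
proof (cases s)
  case (State i r a)
  show ?thesis
    using assms unfolding State
    by (simp add: separation_body_def separation_inv_def less_Suc_eq min_def)
      (auto simp: term_in_def term_out_def breve_L_def breve_U_def)
qed

lemma family_rhs_terms:
  assumes "I \<subseteq> {..<\<eta>}"
  shows "family_rhs {..<\<eta>} \<alpha> w b L U I x z = \<alpha> * ((\<Sum>i<\<eta>. w i * x i) + b) +
    (1 - \<alpha>) * (b * z + (\<Sum>i<\<eta>. if i \<in> I then term_in i else term_out i))"
  unfolding term_in_def term_out_def using assms by (intro family_rhs_eq) auto

lemma violation_le:
  assumes "\<alpha> < 1" "I \<subseteq> {..<\<eta>}"
  shows "family_rhs {..<\<eta>} \<alpha> w b L U {i. i < \<eta> \<and> term_in i \<le> term_out i} x z \<le>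
    family_rhs {..<\<eta>} \<alpha> w b L U I x z"
proof -
  let ?I = "{i. i < \<eta> \<and> term_in i \<le> term_out i}"
  have "(\<Sum>i<\<eta>. if i \<in> ?I then term_in i else term_out i) \<le>
    (\<Sum>i<\<eta>. if i \<in> I then term_in i else term_out i)"
    by (rule sum_mono) auto
  then show ?thesis
    unfolding family_rhs_terms[OF assms(2)] using assms(1)
    by (subst family_rhs_terms) (auto intro!: mult_left_mono)
qed

text \<open>Since \<open>v\<close> is the smallest right-hand side, the single comparison of
  \<open>y\<close> with \<open>v\<close> decides whether any inequality is violated.\<close>

lemma separation_final_correct:
  assumes \<alpha>: "\<alpha> < 1" and inv: "separation_inv \<eta> s"
  shows "correct_separation \<eta> \<alpha> w b L U x y z (result separation_final s)"
proof (cases s)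
  case (State i r a)
  let ?I = "{i. i < \<eta> \<and> term_in i \<le> term_out i}"
  define v where "v = family_rhs {..<\<eta>} \<alpha> w b L U ?I x z"
  have "(\<Sum>i<\<eta>. if i \<in> ?I then term_in i else term_out i) =
    (\<Sum>i<\<eta>. min (term_in i) (term_out i))"
    by (rule sum.cong) auto
  then have v: "v = \<alpha> * ((\<Sum>i<\<eta>. w i * x i) + b) +
      (1 - \<alpha>) * ((\<Sum>i<\<eta>. min (term_in i) (term_out i)) + b * z)"
    unfolding v_def by (subst family_rhs_terms) auto
  have reg0: "reg (result separation_final s) 0 = (if y \<le> v then 0 else 1)"
    using inv by (simp add: State separation_final_def separation_inv_def v)
  have "arr (result separation_final s) 4 = arr s 4"
    by (simp add: State separation_final_def)
  then have out: "output_set \<eta> (result separation_final s) = ?I"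
    using inv by (auto simp: output_set_def separation_inv_def)
  have "v \<le> family_rhs {..<\<eta>} \<alpha> w b L U I x z" if "I \<subseteq> {..<\<eta>}" for I
    using violation_le[OF \<alpha> that] by (simp add: v_def)
  then show ?thesis
    unfolding correct_separation_def Let_def out v_def[symmetric] reg0
    by (auto intro: order_trans)
qed

text \<open>The loop takes at most 17 steps per index (test and body) and 1 for its last test;
  initialisation and final part add at most 2 and 9.\<close>

lemma separation_program_correct:
  assumes "\<alpha> < 1"
  shows "\<exists>t s. runs separation_program (input_state \<eta> \<alpha> w b L U x y z) t s \<and>
    t \<le> 17 * \<eta> + 12 \<and> correct_separation \<eta> \<alpha> w b L U x y z s"
proof -
  let ?s = "input_state \<eta> \<alpha> w b L U x y z"
  obtain t1 where t1: "t1 \<le> 2" "runs separation_init ?s t1 (result separation_init ?s)"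
    using runs_loop_free[of separation_init ?s] by (auto simp: separation_blocks)
  obtain t2 s2 where t2: "t2 \<le> 17 * \<eta> + 1" "separation_inv \<eta> s2"
    "runs (While (ILess 1 0) separation_body) (result separation_init ?s) t2 s2"
  proof -
    have "holds (ILess 1 0) s \<and> separation_inv (Suc k) (result separation_body s)"
      if "separation_inv k s" "k < \<eta>" for k s
      using that separation_body_inv[OF that] by (simp add: separation_inv_def)
    moreover have "\<not> holds (ILess 1 0) s" if "separation_inv \<eta> s" for s
      using that by (simp add: separation_inv_def)
    ultimately have "\<exists>t s'. runs (While (ILess 1 0) separation_body) (result separation_init ?s) t s' \<and>
        t \<le> (\<eta> - 0) * (cost separation_body + 1) + 1 \<and> separation_inv \<eta> s'"
      by (intro runs_counting_loop separation_blocks separation_init_inv) auto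
    then show ?thesis using that by (auto simp: separation_blocks mult.commute)
  qed
  obtain t3 where t3: "t3 \<le> 9" "runs separation_final s2 t3 (result separation_final s2)"
    using runs_loop_free[of separation_final s2] by (auto simp: separation_blocks)
  have "runs separation_program ?s (t1 + (t2 + t3)) (result separation_final s2)"
    unfolding separation_program_def using t1 t2 t3 by (intro runs_Seq)
  moreover have "t1 + (t2 + t3) \<le> 17 * \<eta> + 12" using t1 t2 t3 by simp
  ultimately show ?thesis using separation_final_correct[OF assms t2(2)] by blast
qed

end

lemma separable_in_linear_time: "\<exists>T. T \<in> O(\<lambda>\<eta>. real \<eta>) \<and> separable_in_time T"
proof (intro exI conjI)
  \<comment> \<open>For \<open>\<eta> \<ge> 1\<close> the constant 12 is at most
    \<open>12 * \<eta>\<close>, whence \<open>29 = 17 + 12\<close>.\<close>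
  have "\<forall>\<^sub>F \<eta> in sequentially. norm (17 * real \<eta> + 12) \<le> 29 * norm (real \<eta>)"
    using eventually_ge_at_top[of 1] by eventually_elim simp
  then show "(\<lambda>\<eta>. 17 * real \<eta> + 12) \<in> O(\<lambda>\<eta>. real \<eta>)" by (rule bigoI)
  show "separable_in_time (\<lambda>\<eta>. 17 * real \<eta> + 12)"
    unfolding separable_in_time_def
  proof (intro exI[of _ separation_program] allI impI)
    fix \<eta> \<alpha> w b L U x y z assume "leaky_instance \<eta> \<alpha> w b L U"
    then have "\<alpha> < 1" by (simp add: leaky_instance_def)
    from separation_program_correct[OF this, of \<eta> w b L U x y z]
    obtain t s where "runs separation_program (input_state \<eta> \<alpha> w b L U x y z) t s"
      "t \<le> 17 * \<eta> + 12" "correct_separation \<eta> \<alpha> w b L U x y z s" by blast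
    moreover from this(2) have "real t \<le> 17 * real \<eta> + 12" by linarith
    ultimately show "\<exists>t s. runs separation_program (input_state \<eta> \<alpha> w b L U x y z) t s \<and>
        real t \<le> 17 * real \<eta> + 12 \<and> correct_separation \<eta> \<alpha> w b L U x y z s" by blast
  qed
qed

theorem proposition14:
  fixes \<alpha> b :: real and w L U :: "real^'n"
  assumes "0 < \<alpha>" and "\<alpha> < 1"
    and "\<exists>x \<in> cbox L U. aff w b x > 0"
    and "\<exists>x \<in> cbox L U. aff w b x < 0"
  shows "mip_formulation (bigM_polyhedron \<alpha> w b L U) (leaky_graph \<alpha> w b L U)
    \<and> ideal_formulation (ideal_polyhedron \<alpha> w b L U) (leaky_graph \<alpha> w b L U)
    \<and> (\<exists>T. T \<in> O(\<lambda>\<eta>. real \<eta>) \<and> separable_in_time T)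
    \<and> (\<forall>Q \<in> {bigM_polyhedron \<alpha> w b L U, ideal_polyhedron \<alpha> w b L U}.
        facet_defining Q (\<lambda>(x, y, z). aff w b x) (\<lambda>(x, y, z). y)
      \<and> facet_defining Q (\<lambda>(x, y, z). \<alpha> * aff w b x) (\<lambda>(x, y, z). y)
      \<and> facet_defining Q (\<lambda>(x, y, z). y) (\<lambda>(x, y, z). bigM_lower \<alpha> w b L U x z)
      \<and> facet_defining Q (\<lambda>(x, y, z). y) (\<lambda>(x, y, z). bigM_upper \<alpha> w b L U x z)
      \<and> (\<forall>I \<subseteq> UNIV. facet_defining Q (\<lambda>(x, y, z). y)
          (\<lambda>(x, y, z). family_rhs UNIV \<alpha> (($) w) b (($) L) (($) U) I (($) x) z)))"
proof -
  interpret leaky_neuron \<alpha> b w L U by unfold_locales (fact assms)+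
  have "facet_defining Q (\<lambda>(x, y, z). f x) (\<lambda>(x, y, z). y)
      \<and> facet_defining Q (\<lambda>(x, y, z). \<alpha> * f x) (\<lambda>(x, y, z). y)
      \<and> facet_defining Q (\<lambda>(x, y, z). y) (\<lambda>(x, y, z). bigM_lower \<alpha> w b L U x z)
      \<and> facet_defining Q (\<lambda>(x, y, z). y) (\<lambda>(x, y, z). bigM_upper \<alpha> w b L U x z)
      \<and> (\<forall>I \<subseteq> UNIV. facet_defining Q (\<lambda>(x, y, z). y)
          (\<lambda>(x, y, z). family_rhs UNIV \<alpha> (($) w) b (($) L) (($) U) I (($) x) z))"
    if "Q \<in> {bigM_polyhedron \<alpha> w b L U, ideal_polyhedron \<alpha> w b L U}" for Q
  proof -
    \<comment> \<open>Being facet-defining depends on \<open>Q\<close> only through its binary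
      points, so both relaxations are treated at once.\<close>
    have Q: "binary_part Q = leaky_binary" using that binary_part_eq by auto
    show ?thesis
      using slope_below_facet[OF Q] rhs_facet[OF Q]
      by (simp add: bigM_lower_eq bigM_upper_eq rhs_def)
  qed
  then show ?thesis using mip_formulations(1) ideal separable_in_linear_time by blast
qed

end
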